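(* Let $b\neq0$ be a real number, let $F:\mathbb{R}\to\mathbb{R}$ and $\varepsilon:\mathbb{R}^2\to\mathbb{R}$ be smooth functions, and let $H_1,H_2$ be the Hénon-like maps of the plane $$H_1:\ \bar x=y,\ \ \bar y=bx+F(y),\qquad H_2:\ \bar x=y,\ \ \bar y=\tfrac1b x-\tfrac1b F(y).$$ The map $\tilde H_{12}^{-1}:(x,y)\mapsto(\bar x,\bar y)$ given by $$\bar x=\frac1b x-\frac1b F(\bar y)+\varepsilon(x,\bar y),\qquad y=\frac1b\bar y-\frac1b F(x)+\varepsilon(\bar y,x)$$ is a reversible perturbation of $H_1^{-1}\circ H_2^{-1}$ that keeps the involution $h:(x,y)\mapsto(y,x)$; that is, it coincides with $H_1^{-1}\circ H_2^{-1}$ when $\varepsilon\equiv0$, and it is reversible with respect to $h$. Moreover, its Jacobian at $(x,y)$ (wherever the relations define a smooth map on an open set) is $$J\bigl(\tilde H_{12}^{-1}\bigr)=\frac{1+b\,\varepsilon_x(x,\bar y)}{1+b\,\varepsilon_x(\bar y,x)}.$$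
   Context: $\tilde H_{12}^{-1}$ is just the name of the map defined by the displayed relations. A diffeomorphism $f$ is reversible with respect to an involution $h$ ($h^2=\mathrm{Id}$) if $f=h\circ f^{-1}\circ h$. Since the map here is given implicitly, it is identified with its graph, i.e. the set of pairs $((x,y),(\bar x,\bar y))$ satisfying the two relations; $f^{-1}$ is the inverse relation, and $f=h\circ f^{-1}\circ h$ is understood as equality of graphs (that is, $(p,q)$ belongs to the graph if and only if $(h(q),h(p))$ does). When the relations define a diffeomorphism this is the usual notion. The subscript $x$ on a function of two variables denotes differentiation with respect to its first argument, evaluated at the indicated point. The Jacobian is the determinant $J=\frac{\partial\bar x}{\partial x}\frac{\partial\bar y}{\partial y}-\frac{\partial\bar x}{\partial y}\frac{\partial\bar y}{\partial x}$. *)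

theory Defs
  imports "HOL-Analysis.Analysis"
begin

(* k-fold continuous differentiability on an open set S: all iterated directional
   derivatives up to order k exist (as Frechet derivatives) and are continuous. *)
primrec Ck_on :: "nat \<Rightarrow> 'a::real_normed_vector set \<Rightarrow> ('a \<Rightarrow> 'b::real_normed_vector) \<Rightarrow> bool" where
  "Ck_on 0 S f \<longleftrightarrow> continuous_on S f"
| "Ck_on (Suc k) S f \<longleftrightarrow>
     (\<forall>p\<in>S. f differentiable (at p)) \<and>
     (\<forall>v. Ck_on k S (\<lambda>p. frechet_derivative f (at p) v))"

definition smooth_on :: "'a::real_normed_vector set \<Rightarrow> ('a \<Rightarrow> 'b::real_normed_vector) \<Rightarrow> bool" where
  "smooth_on S f \<longleftrightarrow> (\<forall>k. Ck_on k S f)"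

definition partial1 :: "(real \<times> real \<Rightarrow> real) \<Rightarrow> real \<times> real \<Rightarrow> real" where
  "partial1 f p = deriv (\<lambda>t. f (t, snd p)) (fst p)"

definition partial2 :: "(real \<times> real \<Rightarrow> real) \<Rightarrow> real \<times> real \<Rightarrow> real" where
  "partial2 f p = deriv (\<lambda>t. f (fst p, t)) (snd p)"

definition jacobian_det :: "(real \<times> real \<Rightarrow> real \<times> real) \<Rightarrow> real \<times> real \<Rightarrow> real" where
  "jacobian_det g p =
     partial1 (\<lambda>q. fst (g q)) p * partial2 (\<lambda>q. snd (g q)) p
   - partial2 (\<lambda>q. fst (g q)) p * partial1 (\<lambda>q. snd (g q)) p"

definition map_graph :: "('a \<Rightarrow> 'b) \<Rightarrow> ('a \<times> 'b) set" where
  "map_graph f = {(p, q). q = f p}"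

(* f = h o f^{-1} o h, read for a relation R in place of f: the graph of h o R^{-1} o h
   consists of the pairs (p, q) with (h q, h p) in R. *)
definition reversible_wrt :: "('a \<Rightarrow> 'a) \<Rightarrow> ('a \<times> 'a) set \<Rightarrow> bool" where
  "reversible_wrt h R \<longleftrightarrow> h \<circ> h = id \<and> (\<forall>p q. (p, q) \<in> R \<longleftrightarrow> (h q, h p) \<in> R)"

definition H1 :: "real \<Rightarrow> (real \<Rightarrow> real) \<Rightarrow> real \<times> real \<Rightarrow> real \<times> real" where
  "H1 b F = (\<lambda>(x, y). (y, b * x + F y))"

definition H2 :: "real \<Rightarrow> (real \<Rightarrow> real) \<Rightarrow> real \<times> real \<Rightarrow> real \<times> real" where
  "H2 b F = (\<lambda>(x, y). (y, 1 / b * x - 1 / b * F y))"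

(* b \<noteq> 0 makes inv (H1 b F) and inv (H2 b F) genuine two-sided inverses. *)
lemma bij_H1: "b \<noteq> 0 \<Longrightarrow> bij (H1 b F)"
  by (rule bij_betw_byWitness[where f' = "\<lambda>(x, y). ((y - F x) / b, x)"])
     (auto simp: H1_def field_simps)

lemma bij_H2: "b \<noteq> 0 \<Longrightarrow> bij (H2 b F)"
  by (rule bij_betw_byWitness[where f' = "\<lambda>(x, y). (b * y + F x, x)"])
     (auto simp: H2_def field_simps)

(* The map is given implicitly (the second relation determines y' only implicitly),
   so it is represented by its graph. *)
definition H12_inv_pert ::
    "real \<Rightarrow> (real \<Rightarrow> real) \<Rightarrow> (real \<times> real \<Rightarrow> real) \<Rightarrow> ((real \<times> real) \<times> (real \<times> real)) set" where
  "H12_inv_pert b F \<epsilon> = {((x, y), (x', y')).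
     x' = 1 / b * x - 1 / b * F y' + \<epsilon> (x, y') \<and>
     y = 1 / b * y' - 1 / b * F x + \<epsilon> (y', x)}"

end

theory Submission
  imports Defs
begin

text \<open>
  Write the two relations in \<^emph>\<open>cross form\<close>: \<open>x' = A (x, y')\<close> and \<open>y = B (x, y')\<close>, where
  \<open>A (x, y') = (x - F y') / b + \<epsilon> (x, y')\<close> and \<open>B (x, y') = A (y', x)\<close>. All three claims
  can be read off from this form.

  Without perturbation the second relation can be solved for \<open>y' = b y + F x\<close>, and the result
  is the composition of the explicit inverses of the two Henon-like maps.

  Reversibility is the symmetry \<open>B (x, y') = A (y', x)\<close>: exchanging \<open>(x, y)\<close> with \<open>(y', x')\<close>
  merely exchanges the two relations.

  For the Jacobian, let subscripts denote partial derivatives. Differentiating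
  \<open>y = B (x, y')\<close> with respect to \<open>y\<close> gives \<open>1 = B\<^sub>2 y'\<^sub>y\<close>, so \<open>B\<^sub>2\<close> does not vanish. The
  gradient of \<open>x' = A (x, y')\<close> is \<open>A\<^sub>1\<close> times that of \<open>x\<close> plus \<open>A\<^sub>2\<close> times that of \<open>y'\<close>, and
  the second part is parallel to the second row of the Jacobian matrix. Hence
  \<open>J = A\<^sub>1 y'\<^sub>y = A\<^sub>1 / B\<^sub>2\<close> (\<open>jacobian_det_cross_form\<close>). The result is free of \<open>F\<close>,
  because \<open>A\<^sub>1\<close> and \<open>B\<^sub>2\<close> are derivatives in the variable on which the \<open>F\<close>-term does not depend.
\<close>

lemma smooth_on_imp_differentiable:
  assumes "smooth_on S f" and "p \<in> S"
  shows "f differentiable (at p)"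
proof -
  have "Ck_on (Suc 0) S f" using assms(1) unfolding smooth_on_def by blast
  then show ?thesis using assms(2) by simp
qed

lemma has_derivative_along_curve:
  fixes f :: "real \<times> real \<Rightarrow> real"
  assumes f: "(f has_derivative D) (at (u s, v s))"
    and u: "(u has_real_derivative u') (at s)" and v: "(v has_real_derivative v') (at s)"
  shows "((\<lambda>t. f (u t, v t)) has_real_derivative (u' * D (1, 0) + v' * D (0, 1))) (at s)"
proof -
  interpret D: linear D by (rule has_derivative_linear[OF f])
  have "((\<lambda>t. (u t, v t)) has_derivative (\<lambda>h. (u' * h, v' * h))) (at s)"
    using u v by (intro has_derivative_Pair) (simp_all add: has_field_derivative_def)
  from has_derivative_compose[OF this f]
  have "((\<lambda>t. f (u t, v t)) has_derivative (\<lambda>h. D (u' * h, v' * h))) (at s)" .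
  moreover have "D (u' * h, v' * h) = (u' * D (1, 0) + v' * D (0, 1)) * h" for h
  proof -
    have "(u' * h, v' * h) = (u' * h) *\<^sub>R (1, 0) + (v' * h) *\<^sub>R (0, 1)" by simp
    then have "D (u' * h, v' * h) = (u' * h) *\<^sub>R D (1, 0) + (v' * h) *\<^sub>R D (0, 1)"
      by (metis D.add D.scale)
    then show ?thesis by (simp add: algebra_simps)
  qed
  ultimately show ?thesis by (simp add: has_field_derivative_def)
qed

lemma partial1_eqI:
  "((\<lambda>t. f (t, y)) has_real_derivative d) (at x) \<Longrightarrow> partial1 f (x, y) = d"
  unfolding partial1_def by (simp add: DERIV_imp_deriv)

lemma partial2_eqI:
  "((\<lambda>t. f (x, t)) has_real_derivative d) (at y) \<Longrightarrow> partial2 f (x, y) = d"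
  unfolding partial2_def by (simp add: DERIV_imp_deriv)

text \<open>
  The partial derivatives are defined by \<^const>\<open>deriv\<close> along the coordinate lines. For a
  totally differentiable function they are the values of the total derivative on the unit
  vectors, which makes them usable along every differentiable curve.
\<close>
lemma chain_rule_partials:
  fixes f :: "real \<times> real \<Rightarrow> real"
  assumes "f differentiable (at (u s, v s))"
    and "(u has_real_derivative u') (at s)" and "(v has_real_derivative v') (at s)"
  shows "((\<lambda>t. f (u t, v t)) has_real_derivative
           (u' * partial1 f (u s, v s) + v' * partial2 f (u s, v s))) (at s)"
proof -
  obtain D where D: "(f has_derivative D) (at (u s, v s))"
    using assms(1) by (auto simp: differentiable_def)
  have "partial1 f (u s, v s) = D (1, 0)"
    using has_derivative_along_curve[of f D "\<lambda>t. t" "u s" "\<lambda>t. v s" 1 0] D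
    by (intro partial1_eqI) simp
  moreover have "partial2 f (u s, v s) = D (0, 1)"
    using has_derivative_along_curve[of f D "\<lambda>t. u s" "v s" "\<lambda>t. t" 0 1] D
    by (intro partial2_eqI) simp
  ultimately show ?thesis using has_derivative_along_curve[OF D assms(2,3)] by simp
qed

lemma has_partial1:
  fixes f :: "real \<times> real \<Rightarrow> real"
  assumes "f differentiable (at (x, y))"
  shows "((\<lambda>t. f (t, y)) has_real_derivative partial1 f (x, y)) (at x)"
  using chain_rule_partials[of f "\<lambda>t. t" x "\<lambda>t. y" 1 0] assms by simp

lemma has_partial2:
  fixes f :: "real \<times> real \<Rightarrow> real"
  assumes "f differentiable (at (x, y))"
  shows "((\<lambda>t. f (x, t)) has_real_derivative partial2 f (x, y)) (at y)"
  using chain_rule_partials[of f "\<lambda>t. x" y "\<lambda>t. t" 0 1] assms by simp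

text \<open>
  The area distortion of a planar map in cross form. With \<open>Y = snd \<circ> g\<close>, the relation
  \<open>fst \<circ> g = A (x, Y)\<close> is differentiated in both directions; for \<open>y = B (x, Y)\<close> the
  \<open>y\<close>-derivative suffices, since the \<open>x\<close>-derivative of \<open>Y\<close> cancels from the determinant.
\<close>
lemma jacobian_det_cross_form:
  fixes g :: "real \<times> real \<Rightarrow> real \<times> real" and A B :: "real \<times> real \<Rightarrow> real"
  assumes U: "open U" "(x, y) \<in> U" and g: "g differentiable (at (x, y))"
    and A: "A differentiable (at (x, snd (g (x, y))))"
    and B: "B differentiable (at (x, snd (g (x, y))))"
    and fst_eq: "\<And>s t. (s, t) \<in> U \<Longrightarrow> fst (g (s, t)) = A (s, snd (g (s, t)))"
    and snd_eq: "\<And>s t. (s, t) \<in> U \<Longrightarrow> t = B (s, snd (g (s, t)))"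
  shows "partial2 B (x, snd (g (x, y))) \<noteq> 0"
    and "jacobian_det g (x, y) =
           partial1 A (x, snd (g (x, y))) / partial2 B (x, snd (g (x, y)))"
proof -
  define Y where "Y = (\<lambda>q. snd (g q))"
  let ?z = "(x, Y (x, y))"
  have Y: "Y differentiable (at (x, y))"
    using g unfolding Y_def differentiable_def by (blast intro: has_derivative_snd)
  note Y1 = has_partial1[OF Y] and Y2 = has_partial2[OF Y]
  have A: "A differentiable (at ?z)" and B: "B differentiable (at ?z)"
    using A B by (simp_all add: Y_def)
  \<comment> \<open>The relations hold on neighbourhoods of \<open>x\<close> and \<open>y\<close> in the coordinate lines through
    \<open>(x, y)\<close>, so they may be differentiated along these lines.\<close>
  have U1: "open ((\<lambda>s. (s, y)) -` U)" and U2: "open ((\<lambda>t. (x, t)) -` U)"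
    using U(1) by (auto intro!: open_vimage continuous_intros)
  have "((\<lambda>s. A (s, Y (s, y))) has_real_derivative
          (1 * partial1 A ?z + partial1 Y (x, y) * partial2 A ?z)) (at x)"
    by (rule chain_rule_partials[of A "\<lambda>s. s" x "\<lambda>s. Y (s, y)"]) (use A Y1 in auto)
  then have "((\<lambda>s. fst (g (s, y))) has_real_derivative
          (1 * partial1 A ?z + partial1 Y (x, y) * partial2 A ?z)) (at x)"
    by (rule has_field_derivative_transform_within_open[OF _ U1])
      (use U(2) in \<open>simp_all add: fst_eq Y_def\<close>)
  then have X1: "partial1 (\<lambda>q. fst (g q)) (x, y) =
      partial1 A ?z + partial1 Y (x, y) * partial2 A ?z"
    using partial1_eqI[of "\<lambda>q. fst (g q)"] by simp
  have "((\<lambda>t. A (x, Y (x, t))) has_real_derivative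
          (0 * partial1 A ?z + partial2 Y (x, y) * partial2 A ?z)) (at y)"
    by (rule chain_rule_partials[of A "\<lambda>t. x" y "\<lambda>t. Y (x, t)"]) (use A Y2 in auto)
  then have "((\<lambda>t. fst (g (x, t))) has_real_derivative
          (0 * partial1 A ?z + partial2 Y (x, y) * partial2 A ?z)) (at y)"
    by (rule has_field_derivative_transform_within_open[OF _ U2])
      (use U(2) in \<open>simp_all add: fst_eq Y_def\<close>)
  then have X2: "partial2 (\<lambda>q. fst (g q)) (x, y) = partial2 Y (x, y) * partial2 A ?z"
    using partial2_eqI[of "\<lambda>q. fst (g q)"] by simp
  have "((\<lambda>t. B (x, Y (x, t))) has_real_derivative
          (0 * partial1 B ?z + partial2 Y (x, y) * partial2 B ?z)) (at y)"
    by (rule chain_rule_partials[of B "\<lambda>t. x" y "\<lambda>t. Y (x, t)"]) (use B Y2 in auto)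
  then have "((\<lambda>t. t) has_real_derivative
          (0 * partial1 B ?z + partial2 Y (x, y) * partial2 B ?z)) (at y)"
    by (rule has_field_derivative_transform_within_open[OF _ U2])
      (use U(2) in \<open>simp_all add: snd_eq[symmetric] Y_def\<close>)
  then have Y2_B2: "partial2 Y (x, y) * partial2 B ?z = 1"
    using DERIV_unique[OF _ DERIV_ident] by fastforce
  then show "partial2 B (x, snd (g (x, y))) \<noteq> 0" by (auto simp: Y_def)
  then have "partial2 Y (x, y) = 1 / partial2 B ?z"
    using Y2_B2 by (simp add: field_simps Y_def)
  moreover have "jacobian_det g (x, y) = partial1 A ?z * partial2 Y (x, y)"
    unfolding jacobian_det_def X1 X2 Y_def[symmetric] by (simp add: algebra_simps)
  ultimately show "jacobian_det g (x, y) =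
      partial1 A (x, snd (g (x, y))) / partial2 B (x, snd (g (x, y)))"
    by (simp add: Y_def)
qed

lemma inv_H1: "b \<noteq> 0 \<Longrightarrow> inv (H1 b F) (x, y) = ((y - F x) / b, x)"
  by (rule inv_f_eq[OF bij_is_inj[OF bij_H1]]) (simp_all add: H1_def)

lemma inv_H2: "b \<noteq> 0 \<Longrightarrow> inv (H2 b F) (x, y) = (b * y + F x, x)"
  by (rule inv_f_eq[OF bij_is_inj[OF bij_H2]]) (simp_all add: H2_def field_simps)

lemma H12_inv_pert_unperturbed:
  assumes "b \<noteq> 0" and "\<And>p. \<epsilon> p = 0"
  shows "H12_inv_pert b F \<epsilon> = map_graph (inv (H1 b F) \<circ> inv (H2 b F))"
  using assms by (auto simp: H12_inv_pert_def map_graph_def inv_H1 inv_H2 field_simps)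

lemma H12_inv_pert_reversible:
  "reversible_wrt (\<lambda>(x, y). (y, x)) (H12_inv_pert b F \<epsilon>)"
  by (auto simp: reversible_wrt_def H12_inv_pert_def fun_eq_iff)

text \<open>The right-hand side of the first relation; the second one uses it with its arguments
  exchanged.\<close>
definition cross_map :: "real \<Rightarrow> (real \<Rightarrow> real) \<Rightarrow> (real \<times> real \<Rightarrow> real) \<Rightarrow> real \<times> real \<Rightarrow> real" where
  "cross_map b F \<epsilon> = (\<lambda>p. 1 / b * fst p - 1 / b * F (snd p) + \<epsilon> p)"

lemma H12_inv_pert_iff_cross_map:
  "((x, y), (x', y')) \<in> H12_inv_pert b F \<epsilon> \<longleftrightarrow>
     x' = cross_map b F \<epsilon> (x, y') \<and> y = cross_map b F \<epsilon> (y', x)"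
  by (simp add: H12_inv_pert_def cross_map_def)

lemma cross_map_differentiable:
  assumes "F differentiable (at (snd p))" and "\<epsilon> differentiable (at p)"
  shows "cross_map b F \<epsilon> differentiable (at p)"
proof -
  have "(\<lambda>p. F (snd p)) differentiable (at p)"
    using differentiable_chain_at[of snd p F] assms(1)
    by (simp add: o_def bounded_linear_imp_differentiable bounded_linear_snd)
  moreover have "fst differentiable (at p)"
    by (simp add: bounded_linear_imp_differentiable bounded_linear_fst)
  ultimately show ?thesis unfolding cross_map_def using assms(2)
    by (intro differentiable_add differentiable_diff differentiable_mult differentiable_const)
qed

lemma partial1_cross_map:
  assumes "\<epsilon> differentiable (at p)"
  shows "partial1 (cross_map b F \<epsilon>) p = 1 / b + partial1 \<epsilon> p"
proof -
  obtain x y where p: "p = (x, y)" by (cases p)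
  have "((\<lambda>t. \<epsilon> (t, y)) has_real_derivative partial1 \<epsilon> (x, y)) (at x)"
    using has_partial1 assms p by blast
  then have "((\<lambda>t. c * t - d + \<epsilon> (t, y)) has_real_derivative (c + partial1 \<epsilon> (x, y))) (at x)"
    for c d by (auto intro!: derivative_eq_intros)
  from this[of "1 / b" "1 / b * F y"]
  have "((\<lambda>t. cross_map b F \<epsilon> (t, y)) has_real_derivative (1 / b + partial1 \<epsilon> (x, y))) (at x)"
    by (simp add: cross_map_def)
  then show ?thesis unfolding p by (rule partial1_eqI)
qed

theorem lemma5:
  fixes b :: real and F :: "real \<Rightarrow> real" and \<epsilon> :: "real \<times> real \<Rightarrow> real"
  assumes "b \<noteq> 0" and "smooth_on UNIV F" and "smooth_on UNIV \<epsilon>"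
  shows "((\<forall>p. \<epsilon> p = 0) \<longrightarrow> H12_inv_pert b F \<epsilon> = map_graph (inv (H1 b F) \<circ> inv (H2 b F)))
    \<and> reversible_wrt (\<lambda>(x, y). (y, x)) (H12_inv_pert b F \<epsilon>)
    \<and> (\<forall>U g. open U \<longrightarrow> smooth_on U g \<longrightarrow> (\<forall>p\<in>U. (p, g p) \<in> H12_inv_pert b F \<epsilon>) \<longrightarrow>
         (\<forall>x y x' y'. (x, y) \<in> U \<longrightarrow> g (x, y) = (x', y') \<longrightarrow>
            1 + b * partial1 \<epsilon> (y', x) \<noteq> 0 \<and>
            jacobian_det g (x, y) = (1 + b * partial1 \<epsilon> (x, y')) / (1 + b * partial1 \<epsilon> (y', x))))"
proof (intro conjI)
  show "(\<forall>p. \<epsilon> p = 0) \<longrightarrow> H12_inv_pert b F \<epsilon> = map_graph (inv (H1 b F) \<circ> inv (H2 b F))"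
    using H12_inv_pert_unperturbed assms(1) by blast
  show "reversible_wrt (\<lambda>(x, y). (y, x)) (H12_inv_pert b F \<epsilon>)"
    by (rule H12_inv_pert_reversible)
  show "\<forall>U g. open U \<longrightarrow> smooth_on U g \<longrightarrow> (\<forall>p\<in>U. (p, g p) \<in> H12_inv_pert b F \<epsilon>) \<longrightarrow>
         (\<forall>x y x' y'. (x, y) \<in> U \<longrightarrow> g (x, y) = (x', y') \<longrightarrow>
            1 + b * partial1 \<epsilon> (y', x) \<noteq> 0 \<and>
            jacobian_det g (x, y) = (1 + b * partial1 \<epsilon> (x, y')) / (1 + b * partial1 \<epsilon> (y', x)))"
  proof (intro allI impI)
    fix U g x y x' y'
    assume U: "open U" "(x, y) \<in> U" and g: "smooth_on U g"
      and graph: "\<forall>p\<in>U. (p, g p) \<in> H12_inv_pert b F \<epsilon>" and gxy: "g (x, y) = (x', y')"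
    define A where "A = cross_map b F \<epsilon>"
    define B where "B = (\<lambda>q. A (prod.swap q))"
    have \<epsilon>_diff: "\<epsilon> differentiable (at p)" for p
      using smooth_on_imp_differentiable[OF assms(3)] by simp
    have A_diff: "A differentiable (at p)" for p
      unfolding A_def
      using cross_map_differentiable \<epsilon>_diff smooth_on_imp_differentiable[OF assms(2)] by blast
    have B_diff: "B differentiable (at p)" for p
    proof -
      have "prod.swap differentiable (at p :: (real \<times> real) filter)"
        unfolding prod.swap_def
        by (intro bounded_linear_imp_differentiable bounded_linear_Pair bounded_linear_fst
            bounded_linear_snd)
      then show ?thesis
        using differentiable_chain_at[of prod.swap p A] A_diff by (simp add: B_def o_def)
    qed
    have rel: "fst (g (s, t)) = A (s, snd (g (s, t)))" "t = B (s, snd (g (s, t)))"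
      if "(s, t) \<in> U" for s t
    proof -
      have "((s, t), (fst (g (s, t)), snd (g (s, t)))) \<in> H12_inv_pert b F \<epsilon>"
        using graph that by simp
      then show "fst (g (s, t)) = A (s, snd (g (s, t)))" "t = B (s, snd (g (s, t)))"
        unfolding H12_inv_pert_iff_cross_map A_def B_def by simp_all
    qed
    have A1: "partial1 A (x, y') = 1 / b + partial1 \<epsilon> (x, y')"
      unfolding A_def by (rule partial1_cross_map[OF \<epsilon>_diff])
    have B2: "partial2 B (x, y') = 1 / b + partial1 \<epsilon> (y', x)"
      using partial1_cross_map[OF \<epsilon>_diff, of b F "(y', x)"]
      by (simp add: partial1_def partial2_def A_def B_def)
    note cross = jacobian_det_cross_form[OF U smooth_on_imp_differentiable[OF g U(2)]
        A_diff B_diff rel, unfolded gxy snd_conv A1 B2]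
    have factor: "1 + b * c = b * (1 / b + c)" for c
      using assms(1) by (simp add: field_simps)
    show "1 + b * partial1 \<epsilon> (y', x) \<noteq> 0 \<and>
        jacobian_det g (x, y) = (1 + b * partial1 \<epsilon> (x, y')) / (1 + b * partial1 \<epsilon> (y', x))"
      unfolding factor using assms(1) cross by simp
  qed
qed

end
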